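(* Let $n\ge 1$, let $L\in\mathbb{R}^{n\times n}$ be a nominal liability matrix (with zero diagonal) with net position vector $\mathbf{b}$, and let $(T,\mathbf{0})$ be a balanced payment subsystem of $L$. Then subtracting it does not change the net position vector: the net position vector of the nominal liability matrix $L-T$ equals $\mathbf{b}$.
   Context: A nominal liability matrix is a real $n\times n$ matrix $L$ with zero diagonal, where $L_{ij}$ is the total amount that firm $i$ owes firm $j$. The debt of firm $i$ is $d_i=\sum_{j=1}^n L_{ij}$, its credit is $c_i=\sum_{j=1}^n L_{ji}$, and the net position vector of $L$ is $\mathbf{b}=\mathbf{c}-\mathbf{d}$. A balanced payment subsystem $(T,\mathbf{0})$ of $L$ is a real $n\times n$ matrix $T$ with $0\le T_{ij}\le L_{ij}$ for all $i,j$ such that, with no external cashflow, for every firm the inflow equals the outflow: $\sum_{j}T_{ij}=\sum_{j}T_{ji}$ for all $i$. *)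

theory Defs
  imports "HOL-Analysis.Analysis"
begin

text \<open>
  Firms are the elements of a finite index type, and \<open>L $ i $ j\<close> is the amount
  that firm \<open>i\<close> owes firm \<open>j\<close>.
\<close>

definition nominal_liability_matrix :: "real ^ 'n ^ 'n \<Rightarrow> bool" where
  "nominal_liability_matrix L \<longleftrightarrow> (\<forall>i. L $ i $ i = 0)"

definition debt :: "real ^ 'n ^ 'n \<Rightarrow> real ^ 'n" where
  "debt L = (\<chi> i. \<Sum>j\<in>UNIV. L $ i $ j)"

definition credit :: "real ^ 'n ^ 'n \<Rightarrow> real ^ 'n" where
  "credit L = (\<chi> i. \<Sum>j\<in>UNIV. L $ j $ i)"

definition net_position :: "real ^ 'n ^ 'n \<Rightarrow> real ^ 'n" where
  "net_position L = credit L - debt L"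

text \<open>
  The external cashflow of a balanced payment subsystem \<open>(T, 0)\<close> is the zero vector, so
  only \<open>T\<close> is a parameter.  The bounds on \<open>T\<close> force the entries of \<open>L\<close> to be nonnegative.
\<close>

definition balanced_payment_subsystem :: "real ^ 'n ^ 'n \<Rightarrow> real ^ 'n ^ 'n \<Rightarrow> bool" where
  "balanced_payment_subsystem L T \<longleftrightarrow>
     (\<forall>i j. 0 \<le> T $ i $ j \<and> T $ i $ j \<le> L $ i $ j) \<and>
     (\<forall>i. (\<Sum>j\<in>UNIV. T $ i $ j) = (\<Sum>j\<in>UNIV. T $ j $ i))"

end

theory Submission
  imports Defs
begin

text \<open>The net position is linear in the matrix (\<open>net_position_diff\<close>), and the
  balance condition says exactly that credit and debt of \<open>T\<close> agree, so \<open>T\<close>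
  contributes zero (\<open>net_position_balanced\<close>). Removing circulating payments thus lowers
  each firm's credit and debt by the same amount.\<close>

lemma net_position_diff: "net_position (L - T) = net_position L - net_position T"
  by (simp add: net_position_def credit_def debt_def vec_eq_iff sum_subtractf)

lemma net_position_balanced:
  assumes "balanced_payment_subsystem L T"
  shows "net_position T = 0"
  using assms
  by (simp add: balanced_payment_subsystem_def net_position_def credit_def debt_def vec_eq_iff)

text \<open>The entrywise bounds squeeze the diagonal of \<open>T\<close> between 0 and the zero
  diagonal of \<open>L\<close>. This justifies calling \<open>L - T\<close> a liability matrix in
  the theorem.\<close>

lemma nominal_liability_matrix_diff:
  assumes L: "nominal_liability_matrix L" and T: "balanced_payment_subsystem L T"
  shows "nominal_liability_matrix (L - T)"
  unfolding nominal_liability_matrix_def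
proof
  fix i
  have "0 \<le> T $ i $ i" "T $ i $ i \<le> L $ i $ i"
    using T by (auto simp: balanced_payment_subsystem_def)
  moreover have "L $ i $ i = 0"
    using L by (simp add: nominal_liability_matrix_def)
  ultimately show "(L - T) $ i $ i = 0"
    by simp
qed

theorem theorem16:
  fixes L T :: "real ^ 'n ^ 'n" and b :: "real ^ 'n"
  assumes "nominal_liability_matrix L"
    and "b = net_position L"
    and "balanced_payment_subsystem L T"
  shows "nominal_liability_matrix (L - T) \<and> net_position (L - T) = b"
  using assms
  by (simp add: nominal_liability_matrix_diff net_position_diff net_position_balanced)

end
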